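(* For all integers $n \ge 3$ and $d \ge 3$, the spanning tree congestion of the $d$-dimensional Hamming graph $K_n^d$ satisfies \[ \mathrm{stc}(K_{n}^{d}) \ge \frac{(n^{d}-1)\log_{n} d}{d}. \]
   Context: The $d$-dimensional Hamming graph $K_n^d$ is the graph with vertex set $\{0,\dots,n-1\}^d$ in which two vertices are adjacent if and only if their corresponding vectors differ in exactly one coordinate. For a graph $G$ and $S \subseteq V(G)$, $\partial_G(S)$ denotes the set of edges of $G$ with exactly one endpoint in $S$. For a spanning tree $T$ of a connected graph $G$ and an edge $e \in E(T)$, the congestion of $e$ is $|\partial_G(L_e)|$, where $L_e$ is the vertex set of one of the two components of $T - e$; the congestion of $T$ in $G$ is the maximum congestion over all edges of $T$; and the spanning tree congestion $\mathrm{stc}(G)$ is the minimum congestion of $T$ in $G$ over all spanning trees $T$ of $G$. Here $\log_n$ denotes the logarithm to base $n$. *)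

theory Defs
  imports Complex_Main "Graph_Theory.Graph_Theory"
begin

text \<open>
  A finite simple graph is a symmetric loop-free finite digraph (locale pair_graph): an undirected
  edge with endpoints u and v is the pair of arcs (u, v) and (v, u).
\<close>

definition hamming_graph :: "nat \<Rightarrow> nat \<Rightarrow> (nat \<Rightarrow> nat) pair_pre_digraph" where
  "hamming_graph n d =
     \<lparr> pverts = PiE {..<d} (\<lambda>_. {..<n}),
       parcs = {(x, y). x \<in> PiE {..<d} (\<lambda>_. {..<n}) \<and> y \<in> PiE {..<d} (\<lambda>_. {..<n}) \<and>
                        (\<exists>!i. i < d \<and> x i \<noteq> y i)} \<rparr>"

definition edge_boundary :: "'a pair_pre_digraph \<Rightarrow> 'a set \<Rightarrow> 'a set set" where
  "edge_boundary G S = {{u, v} | u v. (u, v) \<in> parcs G \<and> u \<in> S \<and> v \<notin> S}"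

text \<open>
  The constants forest, tree and spanning_tree of Graph_Theory are not usable here: there the
  closed walk along (u, v), (v, u) counts as a cycle, so no symmetric digraph with an arc is a
  forest. In a simple graph the undirected cycles are the cycles of length at least 3.
\<close>

definition undirected_tree :: "'a pair_pre_digraph \<Rightarrow> bool" where
  "undirected_tree T \<longleftrightarrow>
     pair_graph T \<and> Digraph_Component.connected (with_proj T) \<and>
     \<not> (\<exists>p. pre_digraph.cycle (with_proj T) p \<and> length p \<ge> 3)"

definition undirected_spanning_tree :: "'a pair_pre_digraph \<Rightarrow> 'a pair_pre_digraph \<Rightarrow> bool" where
  "undirected_spanning_tree T G \<longleftrightarrow> undirected_tree T \<and> spanning (with_proj T) (with_proj G)"

definition delete_edge :: "'a pair_pre_digraph \<Rightarrow> 'a \<times> 'a \<Rightarrow> 'a pair_pre_digraph" where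
  "delete_edge T e = T\<lparr> parcs := parcs T - {e, prod.swap e} \<rparr>"

text \<open>
  For an arc e, the component of T - e containing the tail of e. The reversed arc selects the other
  component; both give the same congestion (lemma edge_congestion_swap below). In symmetric
  digraphs the strongly connected components are the connected components.
\<close>

definition edge_side :: "'a pair_pre_digraph \<Rightarrow> 'a \<times> 'a \<Rightarrow> 'a set" where
  "edge_side T e = pre_digraph.scc_of (with_proj (delete_edge T e)) (fst e)"

definition edge_congestion :: "'a pair_pre_digraph \<Rightarrow> 'a pair_pre_digraph \<Rightarrow> 'a \<times> 'a \<Rightarrow> nat" where
  "edge_congestion G T e = card (edge_boundary G (edge_side T e))"

definition congestion :: "'a pair_pre_digraph \<Rightarrow> 'a pair_pre_digraph \<Rightarrow> nat" where
  "congestion G T = Max (edge_congestion G T ` parcs T)"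

definition stc :: "'a pair_pre_digraph \<Rightarrow> nat" where
  "stc G = Min {congestion G T | T. undirected_spanning_tree T G}"


lemma pair_graph_hamming_graph: "pair_graph (hamming_graph n d)"
proof -
  define V :: "(nat \<Rightarrow> nat) set" where "V = PiE {..<d} (\<lambda>_. {..<n})"
  define A where "A = {(x, y). x \<in> V \<and> y \<in> V \<and> (\<exists>!i. i < d \<and> x i \<noteq> y i)}"
  have H: "hamming_graph n d = \<lparr> pverts = V, parcs = A \<rparr>"
    by (simp only: hamming_graph_def V_def A_def)
  have fin: "finite V" unfolding V_def by (rule finite_PiE) simp_all
  have sub: "A \<subseteq> V \<times> V" unfolding A_def by blast
  have finA: "finite A" by (rule finite_subset[OF sub finite_cartesian_product[OF fin fin]])
  have sym: "(y, x) \<in> A" if "(x, y) \<in> A" for x y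
  proof -
    have "(i < d \<and> y i \<noteq> x i) = (i < d \<and> x i \<noteq> y i)" for i by metis
    with that show ?thesis by (simp only: A_def mem_Collect_eq prod.case)
  qed
  have irrefl: "(x, x) \<notin> A" for x unfolding A_def by (simp add: Ex1_def)
  show ?thesis
    unfolding H
  proof
    show "symmetric (with_proj \<lparr> pverts = V, parcs = A \<rparr>)"
      using sym by (simp add: symmetric_def sym_def)
  qed (use fin finA sub irrefl in auto)
qed

lemma edge_boundary_complement:
  assumes "pair_graph G"
  shows "edge_boundary G (pverts G - S) = edge_boundary G S"
proof -
  interpret pair_graph G by fact
  show ?thesis
    unfolding edge_boundary_def
    by (auto dest: wellformed') (metis arcs_symmetric insert_commute wellformed')+
qed

lemma pair_graph_delete_edge:
  assumes "pair_graph T" shows "pair_graph (delete_edge T e)"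
proof -
  interpret pair_graph T by fact
  have "symmetric (with_proj (delete_edge T e))"
    unfolding symmetric_def sym_def
    by (cases e) (auto simp: delete_edge_def intro: arcs_symmetric)
  then show ?thesis
    using pair_finite_verts pair_finite_arcs wellformed' no_loops
    by unfold_locales (auto simp: delete_edge_def)
qed

lemma edge_side_swap:
  assumes tree: "undirected_tree T" and arc: "e \<in> parcs T"
  shows "edge_side T (prod.swap e) = pverts T - edge_side T e"
proof -
  obtain u v where e: "e = (u, v)" by (cases e)
  let ?T' = "delete_edge T e"
  interpret T: pair_graph T using tree by (simp add: undirected_tree_def)
  interpret T': pair_graph ?T' by (rule pair_graph_delete_edge) (rule T.pair_graph)
  have swap: "delete_edge T (prod.swap e) = ?T'"
    by (simp add: delete_edge_def insert_commute)
  have uv: "(u, v) \<in> parcs T" "(v, u) \<in> parcs T" "u \<noteq> v" "u \<in> pverts T" "v \<in> pverts T"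
    using arc e T.arcs_symmetric T.no_loops' T.wellformed' by blast+
  have V: "pverts ?T' = pverts T" by (simp add: delete_edge_def)
  have no: "\<not> u \<rightarrow>\<^sup>*\<^bsub>with_proj ?T'\<^esub> v"
  proof
    assume "u \<rightarrow>\<^sup>*\<^bsub>with_proj ?T'\<^esub> v"
    then obtain p where p: "T'.apath u p v" using T'.reachable_apath by blast
    have aw': "T'.awalk u p v" and dist: "distinct (pawalk_verts u p)"
      using p by (auto simp: T'.apath_def)
    have arcs: "set p \<subseteq> parcs ?T'" and cas: "pcas u p v"
      using aw' by (auto simp: T'.awalk_def)
    have "length ((v, u) # p) \<ge> 3"
    proof (cases p)
      case Nil
      then show ?thesis using cas uv by simp
    next
      case (Cons a q)
      show ?thesis
      proof (cases q)
        case Nil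
        then show ?thesis using Cons cas arcs by (cases a) (auto simp: delete_edge_def e)
      qed (simp add: Cons)
    qed
    moreover have "set p \<subseteq> parcs T" using arcs by (auto simp: delete_edge_def)
    then have "T.awalk v ((v, u) # p) v" using cas uv by (simp add: T.awalk_def)
    then have "T.cycle ((v, u) # p)" using dist by (auto simp: T.cycle_def)
    ultimately show False using tree unfolding undirected_tree_def by blast
  qed
  have cover: "u \<rightarrow>\<^sup>*\<^bsub>with_proj ?T'\<^esub> w \<or> v \<rightarrow>\<^sup>*\<^bsub>with_proj ?T'\<^esub> w" if w: "w \<in> pverts T" for w
  proof -
    have "strongly_connected (with_proj T)"
      using tree T.symmetric_connected_imp_strongly_connected[OF T.sym_arcs]
      by (simp add: undirected_tree_def)
    then have "u \<rightarrow>\<^sup>*\<^bsub>with_proj T\<^esub> w"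
      using w uv by (simp add: strongly_connected_def)
    then show ?thesis
    proof (induction rule: T.reachable_induct)
      case base
      then show ?case using V by (simp add: T'.reachable_refl)
    next
      case (step x y)
      show ?case
      proof (cases "(x, y) \<in> parcs ?T'")
        case True
        then show ?thesis using step.IH by (auto intro: T'.reachable_adj_trans)
      next
        case False
        then have "y = u \<or> y = v" using step.hyps by (auto simp: delete_edge_def e)
        then show ?thesis using uv V by (auto simp: T'.reachable_refl)
      qed
    qed
  qed
  have side: "pre_digraph.scc_of (with_proj ?T') x = {w. x \<rightarrow>\<^sup>*\<^bsub>with_proj ?T'\<^esub> w}" for x
    using symmetric_reachable[OF T'.sym_arcs] by (auto simp: T'.scc_of_def)
  have "\<not> (u \<rightarrow>\<^sup>*\<^bsub>with_proj ?T'\<^esub> w \<and> v \<rightarrow>\<^sup>*\<^bsub>with_proj ?T'\<^esub> w)" for w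
    using no symmetric_reachable[OF T'.sym_arcs] T'.reachable_trans by blast
  moreover have "w \<in> pverts T" if "v \<rightarrow>\<^sup>*\<^bsub>with_proj ?T'\<^esub> w" for w
    using T'.reachable_in_verts(2)[OF that] V by simp
  ultimately show ?thesis
    using cover unfolding edge_side_def swap side by (auto simp: e)
qed

lemma edge_congestion_swap:
  assumes "pair_graph G" "undirected_spanning_tree T G" "e \<in> parcs T"
  shows "edge_congestion G T (prod.swap e) = edge_congestion G T e"
proof -
  have "pverts T = pverts G"
    using assms(2) by (simp add: undirected_spanning_tree_def spanning_def)
  then show ?thesis
    using assms edge_side_swap[of T e] edge_boundary_complement[of G]
    by (simp add: edge_congestion_def undirected_spanning_tree_def)
qed

end

(*
  Let N = n^d. The vertex set S of one side of a tree edge has edge boundary at least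
  (n - 1) * |S| * log_n (N / |S|). This follows from Han's entropy inequality: for X uniform on S,
  the conditional entropies of the coordinates X_i given all other coordinates sum to at most ln |S|,
  and X_i given the others is uniform on the a <= n points of S on a line, where
  a - 1 <= (n - 1) * log_n a by concavity of ln.
  Every tree has a vertex at which all branches have at most N/2 vertices; a spanning tree has at
  most d * (n - 1) branches there, so the largest has (N - 1) / (d * (n - 1)) <= |S| <= N/2.
  If |S| <= N/d then log_n (N / |S|) >= log_n d and the lower bound on |S| suffices; otherwise
  u = N / |S| lies in [2, d] and ln d / d <= 2 * ln u / u suffices.
*)
theory Submission
  imports Defs "HOL-Analysis.Convex"
begin

subsection \<open>Edge isoperimetry in Hamming graphs\<close>

text \<open>For a point uniform on \<open>S\<close>, conditioning on the coordinates outside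
  \<open>I\<close> leaves it uniform on a fibre. So \<open>ln (card (fibre S I x))\<close> is the
  conditional entropy of the coordinates in \<open>I\<close>, and a sum over \<open>S\<close> is
  \<open>card S\<close> times its average.\<close>

definition fibre :: "('i \<Rightarrow> 'a) set \<Rightarrow> 'i set \<Rightarrow> ('i \<Rightarrow> 'a) \<Rightarrow> ('i \<Rightarrow> 'a) set" where
  "fibre S I x = {y \<in> S. \<forall>i. i \<notin> I \<longrightarrow> y i = x i}"

lemma finite_fibre: "finite S \<Longrightarrow> finite (fibre S I x)"
  by (simp add: fibre_def)

lemma card_fibre_pos: "finite S \<Longrightarrow> x \<in> S \<Longrightarrow> 0 < card (fibre S I x)"
  by (auto simp: card_gt_0_iff finite_fibre fibre_def)

lemma fibre_eq: "y \<in> fibre S I x \<Longrightarrow> fibre S I y = fibre S I x"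
  by (auto simp: fibre_def)

text \<open>
  Submodularity of entropy by double counting: for y agreeing with x off I and z agreeing with x
  off j, the pair (y, z) determines x.
\<close>

lemma sum_card_fibre_quotient_le:
  assumes fin: "finite S" and j: "j \<notin> I"
  shows "(\<Sum>x\<in>S. real (card (fibre S I x)) * real (card (fibre S {j} x)) /
            real (card (fibre S (insert j I) x))) \<le> real (card S)"
proof -
  let ?C = "\<lambda>x. real (card (fibre S (insert j I) x))"
  let ?T = "Sigma S (\<lambda>x. fibre S I x \<times> fibre S {j} x)"
  let ?P = "Sigma S (fibre S (insert j I))"
  have sub: "snd ` ?T \<subseteq> ?P"
    by (auto simp: fibre_def)
  have inj: "inj_on snd ?T"
  proof (rule inj_onI)
    fix p q assume p: "p \<in> ?T" and q: "q \<in> ?T" and eq: "snd p = snd q"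
    obtain x y z where pe: "p = (x, y, z)" by (cases p) auto
    obtain x' where qe: "q = (x', y, z)" using eq pe by (cases q) auto
    have "x i = x' i" for i
    proof (cases "i = j")
      case True
      then have "x i = y i" "x' i = y i" using p q j unfolding pe qe by (auto simp: fibre_def)
      then show ?thesis by simp
    next
      case False
      then have "x i = z i" "x' i = z i" using p q unfolding pe qe by (auto simp: fibre_def)
      then show ?thesis by simp
    qed
    then show "p = q" unfolding pe qe by auto
  qed
  \<comment> \<open>The product counts the pairs (y, z). Expressed through y, which shares the
    larger fibre with \<open>x\<close>, the weight survives forgetting \<open>x\<close>.\<close>
  have "(\<Sum>x\<in>S. real (card (fibre S I x)) * real (card (fibre S {j} x)) / ?C x)
      = (\<Sum>x\<in>S. \<Sum>w\<in>fibre S I x \<times> fibre S {j} x. 1 / ?C (fst w))"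
  proof (rule sum.cong[OF refl])
    fix x assume "x \<in> S"
    have "(\<Sum>w\<in>fibre S I x \<times> fibre S {j} x. 1 / ?C (fst w))
        = (\<Sum>w\<in>fibre S I x \<times> fibre S {j} x. 1 / ?C x)"
    proof (rule sum.cong[OF refl])
      fix w assume "w \<in> fibre S I x \<times> fibre S {j} x"
      then have "fst w \<in> fibre S (insert j I) x" by (auto simp: fibre_def)
      then show "1 / ?C (fst w) = 1 / ?C x" by (simp add: fibre_eq)
    qed
    then show "real (card (fibre S I x)) * real (card (fibre S {j} x)) / ?C x
        = (\<Sum>w\<in>fibre S I x \<times> fibre S {j} x. 1 / ?C (fst w))"
      by (simp add: card_cartesian_product)
  qed
  also have "\<dots> = (\<Sum>p\<in>?T. 1 / ?C (fst (snd p)))"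
    by (subst sum.Sigma) (auto simp: fin finite_fibre split_beta)
  also have "\<dots> = (\<Sum>w\<in>snd ` ?T. 1 / ?C (fst w))"
    by (simp add: sum.reindex[OF inj])
  also have "\<dots> \<le> (\<Sum>w\<in>?P. 1 / ?C (fst w))"
    by (rule sum_mono2) (use sub fin in \<open>auto simp: finite_fibre\<close>)
  also have "\<dots> = (\<Sum>y\<in>S. \<Sum>z\<in>fibre S (insert j I) y. 1 / ?C y)"
    by (subst sum.Sigma) (auto simp: fin finite_fibre split_beta)
  also have "\<dots> = (\<Sum>y\<in>S. 1)"
  proof (rule sum.cong[OF refl])
    fix y assume "y \<in> S"
    then have "?C y \<noteq> 0" using card_fibre_pos[OF fin] by simp
    then show "(\<Sum>z\<in>fibre S (insert j I) y. 1 / ?C y) = 1" by simp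
  qed
  finally show ?thesis by simp
qed

text \<open>Applied to each quotient in \<open>sum_card_fibre_quotient_le\<close>, the inequality
  \<open>ln t \<le> t - 1\<close> turns the counting bound into one for conditional
  entropies.\<close>

lemma sum_ln_card_fibre_insert:
  assumes fin: "finite S" and j: "j \<notin> I"
  shows "(\<Sum>x\<in>S. ln (real (card (fibre S I x)))) + (\<Sum>x\<in>S. ln (real (card (fibre S {j} x))))
     \<le> (\<Sum>x\<in>S. ln (real (card (fibre S (insert j I) x))))"
proof -
  let ?A = "\<lambda>I x. real (card (fibre S I x))"
  have "(\<Sum>x\<in>S. ln (?A I x) + ln (?A {j} x) - ln (?A (insert j I) x))
      \<le> (\<Sum>x\<in>S. ?A I x * ?A {j} x / ?A (insert j I) x - 1)"
  proof (rule sum_mono)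
    fix x assume "x \<in> S"
    then have pos: "0 < ?A K x" for K using card_fibre_pos[OF fin] by simp
    have "ln (?A I x) + ln (?A {j} x) - ln (?A (insert j I) x) =
        ln (?A I x * ?A {j} x / ?A (insert j I) x)"
      using pos by (simp add: ln_mult ln_div)
    also have "\<dots> \<le> ?A I x * ?A {j} x / ?A (insert j I) x - 1"
      using pos by (intro ln_le_minus_one) simp
    finally show "ln (?A I x) + ln (?A {j} x) - ln (?A (insert j I) x)
        \<le> ?A I x * ?A {j} x / ?A (insert j I) x - 1" .
  qed
  also have "\<dots> \<le> 0"
    using sum_card_fibre_quotient_le[OF assms] by (simp add: sum_subtractf)
  finally show ?thesis by (simp add: sum_subtractf sum.distrib)
qed

text \<open>Han's inequality, obtained by adding the coordinates in \<open>I\<close> one at a time;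
  the final fibre is still a subset of \<open>S\<close>.\<close>

lemma sum_ln_card_fibre_le:
  assumes fin: "finite S" and "finite I"
  shows "(\<Sum>i\<in>I. \<Sum>x\<in>S. ln (real (card (fibre S {i} x)))) \<le> real (card S) * ln (real (card S))"
proof -
  have "(\<Sum>i\<in>I. \<Sum>x\<in>S. ln (real (card (fibre S {i} x)))) \<le> (\<Sum>x\<in>S. ln (real (card (fibre S I x))))"
    using \<open>finite I\<close>
  proof (induction I)
    case empty
    show ?case
      using card_fibre_pos[OF fin] by (auto intro!: sum_nonneg simp: Suc_le_eq)
  next
    case (insert j I)
    then show ?case using sum_ln_card_fibre_insert[OF fin \<open>j \<notin> I\<close>] by simp
  qed
  also have "\<dots> \<le> (\<Sum>x\<in>S. ln (real (card S)))"
  proof (rule sum_mono)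
    fix x assume "x \<in> S"
    have "card (fibre S I x) \<le> card S"
      by (rule card_mono[OF fin]) (auto simp: fibre_def)
    then show "ln (real (card (fibre S I x))) \<le> ln (real (card S))"
      using card_fibre_pos[OF fin \<open>x \<in> S\<close>, of I] by simp
  qed
  finally show ?thesis by simp
qed

text \<open>A concave function lies above its chord, here from 1 to \<open>n\<close>. If
  \<open>S\<close> has \<open>a\<close> points on a line of \<open>n\<close> points, the number
  \<open>n - a\<close> of missing points is therefore at least
  \<open>(n - 1) * (1 - log n a)\<close>.\<close>

lemma chord_le_ln:
  fixes a n :: real
  assumes "1 \<le> a" "a \<le> n" "1 < n"
  shows "(a - 1) * ln n \<le> (n - 1) * ln a"
proof -
  define t where "t = (a - 1) / (n - 1)"
  have t: "0 \<le> t" "t \<le> 1" "(1 - t) * 1 + t * n = a"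
  proof -
    have "t * (n - 1) = a - 1" using assms by (simp add: t_def)
    then show "(1 - t) * 1 + t * n = a" by (simp add: algebra_simps)
  qed (use assms in \<open>auto simp: t_def\<close>)
  have "(1 - t) * ln 1 + t * ln n \<le> ln ((1 - t) * 1 + t * n)"
    using concave_onD[OF ln_concave t(1,2), of 1 n] assms by simp
  then show ?thesis
    using assms unfolding t(3) by (simp add: t_def field_simps)
qed

section \<open>Arcs, lines and edge boundaries in the Hamming graph\<close>

lemma pverts_hamming_graph: "pverts (hamming_graph n d) = PiE {..<d} (\<lambda>_. {..<n})"
  by (simp add: hamming_graph_def)

lemma card_pverts_hamming_graph: "card (pverts (hamming_graph n d)) = n ^ d"
  by (simp add: pverts_hamming_graph card_PiE)

lemma fun_upd_in_pverts:
  assumes "x \<in> pverts (hamming_graph n d)" "i < d" "t < n"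
  shows "x(i := t) \<in> pverts (hamming_graph n d)"
  using assms by (auto simp: pverts_hamming_graph PiE_iff extensional_def)

lemma fun_upd_in_parcs:
  assumes "x \<in> pverts (hamming_graph n d)" "i < d" "t < n" "x i \<noteq> t"
  shows "(x, x(i := t)) \<in> parcs (hamming_graph n d)"
proof -
  have "\<exists>!k. k < d \<and> x k \<noteq> (x(i := t)) k"
    by (rule ex1I[of _ i]) (use assms in \<open>auto split: if_splits\<close>)
  then show ?thesis
    using assms(1) fun_upd_in_pverts[OF assms(1-3)] by (simp add: hamming_graph_def)
qed

lemma parcs_hamming_graphE:
  assumes "(x, y) \<in> parcs (hamming_graph n d)"
  obtains i t where "i < d" "t < n" "x i \<noteq> t" "y = x(i := t)"
proof -
  have xy: "x \<in> PiE {..<d} (\<lambda>_. {..<n})" "y \<in> PiE {..<d} (\<lambda>_. {..<n})"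
    and ex: "\<exists>!i. i < d \<and> x i \<noteq> y i"
    using assms
    by (simp_all only: hamming_graph_def pair_pre_digraph.select_convs mem_Collect_eq prod.case)
  from ex obtain i where i: "i < d" "x i \<noteq> y i" and uniq: "\<forall>k. k < d \<and> x k \<noteq> y k \<longrightarrow> k = i"
    unfolding Ex1_def by (elim exE conjE)
  \<comment> \<open>At indices from \<open>d\<close> on, both functions have the value
    \<open>undefined\<close>, so no difference is left there.\<close>
  have "y k = (x(i := y i)) k" for k
  proof (cases "k = i \<or> k < d")
    case True
    then show ?thesis using uniq by (cases "k = i") auto
  next
    case False
    then show ?thesis using PiE_arb[OF xy(1), of k] PiE_arb[OF xy(2), of k] by simp
  qed
  then have "y = x(i := y i)" by (rule ext)
  moreover have "y i < n" using PiE_mem[OF xy(2), of i] i by simp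
  ultimately show ?thesis using i that by blast
qed

text \<open>From \<open>x\<close> in \<open>S\<close>, direction \<open>i\<close> offers one
  boundary edge for each point that \<open>S\<close> misses on the line through \<open>x\<close>. A
  boundary edge has just one endpoint in \<open>S\<close>, so none is counted twice.\<close>

lemma card_edge_boundary_hamming_graph:
  assumes S: "S \<subseteq> pverts (hamming_graph n d)"
  shows "(\<Sum>x\<in>S. \<Sum>i<d. real n - real (card (fibre S {i} x)))
      \<le> real (card (edge_boundary (hamming_graph n d) S))"
proof -
  interpret H: pair_graph "hamming_graph n d" by (rule pair_graph_hamming_graph)
  have fin: "finite S" using S H.pair_finite_verts finite_subset by blast
  define B where "B = Sigma S (\<lambda>x. Sigma {..<d} (\<lambda>i. {t. t < n \<and> x(i := t) \<notin> S}))"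
  define f :: "(nat \<Rightarrow> nat) \<times> nat \<times> nat \<Rightarrow> (nat \<Rightarrow> nat) set"
    where "f = (\<lambda>(x, i, t). {x, x(i := t)})"
  have count: "real (card {t. t < n \<and> x(i := t) \<notin> S}) = real n - real (card (fibre S {i} x))"
    if x: "x \<in> S" and i: "i < d" for x i
  proof -
    have "bij_betw (\<lambda>t. x(i := t)) {t. t < n \<and> x(i := t) \<in> S} (fibre S {i} x)"
    proof (rule bij_betwI[where g = "\<lambda>y. y i"])
      show "(\<lambda>y. y i) \<in> fibre S {i} x \<rightarrow> {t. t < n \<and> x(i := t) \<in> S}"
      proof
        fix y assume y: "y \<in> fibre S {i} x"
        then have "x(i := y i) = y" by (auto simp: fibre_def)
        moreover have "y i < n"
          using y S i by (auto simp: fibre_def pverts_hamming_graph)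
        ultimately show "y i \<in> {t. t < n \<and> x(i := t) \<in> S}"
          using y by (auto simp: fibre_def)
      qed
    qed (auto simp: fibre_def)
    then have 1: "card {t. t < n \<and> x(i := t) \<in> S} = card (fibre S {i} x)"
      by (rule bij_betw_same_card)
    have "card {t. t < n \<and> x(i := t) \<in> S} + card {t. t < n \<and> x(i := t) \<notin> S} = card {..<n}"
    proof (subst card_Un_disjoint[symmetric])
      show "card ({t. t < n \<and> x(i := t) \<in> S} \<union> {t. t < n \<and> x(i := t) \<notin> S}) = card {..<n}"
        by (rule arg_cong[where f = card]) auto
    qed auto
    then show ?thesis using 1 by simp
  qed
  have inj: "inj_on f B"
  proof (rule inj_onI)
    fix p q assume p: "p \<in> B" and q: "q \<in> B" and eq: "f p = f q"
    obtain x i t where pe: "p = (x, i, t)" by (cases p) auto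
    obtain y j s where qe: "q = (y, j, s)" by (cases q) auto
    have x: "x \<in> S" "x(i := t) \<notin> S" and y: "y \<in> S" "y(j := s) \<notin> S"
      using p q by (auto simp: B_def pe qe)
    have e: "{x, x(i := t)} = {y, y(j := s)}" using eq by (simp add: f_def pe qe)
    \<comment> \<open>The edge determines its endpoint inside \<open>S\<close>; the other endpoint
      then gives the direction and the new value.\<close>
    then have xy: "x = y" using x y by blast
    with e x y have u: "x(i := t) = x(j := s)" by (auto simp: doubleton_eq_iff)
    have "x i \<noteq> t" using x by auto
    then have "i = j" using fun_cong[OF u, of i] by (auto split: if_splits)
    then have "t = s" using fun_cong[OF u, of i] by simp
    with \<open>i = j\<close> show "p = q" using xy pe qe by simp
  qed
  have img: "f ` B \<subseteq> edge_boundary (hamming_graph n d) S"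
  proof
    fix E assume "E \<in> f ` B"
    then obtain x i t where x: "x \<in> S" "i < d" "t < n" "x(i := t) \<notin> S" and E: "E = {x, x(i := t)}"
      by (auto simp: f_def B_def)
    have "x i \<noteq> t" using x by auto
    then have "(x, x(i := t)) \<in> parcs (hamming_graph n d)"
      using x S by (intro fun_upd_in_parcs) auto
    then show "E \<in> edge_boundary (hamming_graph n d) S"
      using x E unfolding edge_boundary_def by blast
  qed
  have finE: "finite (edge_boundary (hamming_graph n d) S)"
  proof (rule finite_subset)
    show "edge_boundary (hamming_graph n d) S \<subseteq> (\<lambda>(u, v). {u, v}) ` parcs (hamming_graph n d)"
      unfolding edge_boundary_def by auto
  qed (simp add: H.pair_finite_arcs)
  have "(\<Sum>x\<in>S. \<Sum>i<d. real n - real (card (fibre S {i} x))) = real (card B)"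
  proof -
    have "card B = (\<Sum>x\<in>S. \<Sum>i<d. card {t. t < n \<and> x(i := t) \<notin> S})"
      unfolding B_def using fin by simp
    then show ?thesis by (simp add: count)
  qed
  also have "\<dots> \<le> real (card (edge_boundary (hamming_graph n d) S))"
    using card_inj_on_le[OF inj img finE] by simp
  finally show ?thesis .
qed

text \<open>Subcubes with some coordinates fixed and the others free attain equality. For the bound,
  \<open>sum_ln_card_fibre_le\<close> distributes the entropy \<open>ln (card S)\<close> over the
  directions, and \<open>chord_le_ln\<close> turns the share of each line into a count of missing
  points.\<close>

theorem hamming_graph_edge_isoperimetry:
  assumes S: "S \<subseteq> pverts (hamming_graph n d)" and n: "n \<ge> 2"
  shows "(real n - 1) * real (card S) * (real d - log n (card S))
      \<le> real (card (edge_boundary (hamming_graph n d) S))"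
proof -
  interpret H: pair_graph "hamming_graph n d" by (rule pair_graph_hamming_graph)
  have fin: "finite S" using S H.pair_finite_verts finite_subset by blast
  have ln: "ln (real n) > 0" using n by simp
  let ?a = "\<lambda>i x. real (card (fibre S {i} x))"
  have "(real n - 1) * real (card S) * (real d - log n (card S))
      = (real n - 1) * (real d * card S - real (card S) * ln (card S) / ln n)"
    unfolding log_def mult.assoc by (simp only: right_diff_distrib mult.commute times_divide_eq_right)
  also have "\<dots> \<le> (real n - 1) * (real d * card S - (\<Sum>i<d. \<Sum>x\<in>S. ln (?a i x)) / ln n)"
    using sum_ln_card_fibre_le[OF fin, of "{..<d}"] n ln
    by (intro mult_left_mono diff_left_mono divide_right_mono) auto
  also have "\<dots> = (\<Sum>x\<in>S. \<Sum>i<d. (real n - 1) * (1 - ln (?a i x) / ln n))"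
    by (subst (2) sum.swap)
       (simp add: sum_distrib_left[symmetric] sum_subtractf sum_divide_distrib[symmetric])
  also have "\<dots> \<le> (\<Sum>x\<in>S. \<Sum>i<d. real n - ?a i x)"
  proof (intro sum_mono)
    fix x i assume x: "x \<in> S" and i: "i \<in> {..<d}"
    have "inj_on (\<lambda>y. y i) (fibre S {i} x)"
    proof (rule inj_onI)
      fix y z assume "y \<in> fibre S {i} x" "z \<in> fibre S {i} x" "y i = z i"
      then have "y k = z k" for k by (cases "k = i") (simp_all add: fibre_def)
      then show "y = z" by blast
    qed
    moreover have "(\<lambda>y. y i) ` fibre S {i} x \<subseteq> {..<n}"
      using S i by (auto simp: fibre_def pverts_hamming_graph)
    ultimately have "card (fibre S {i} x) \<le> n"
      using card_inj_on_le[of "\<lambda>y. y i" "fibre S {i} x" "{..<n}"] by simp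
    then have "(?a i x - 1) * ln n \<le> (real n - 1) * ln (?a i x)"
      using card_fibre_pos[OF fin x, of "{i}"] n by (intro chord_le_ln) auto
    then show "(real n - 1) * (1 - ln (?a i x) / ln n) \<le> real n - ?a i x"
      using ln by (simp add: field_simps)
  qed
  also have "\<dots> \<le> real (card (edge_boundary (hamming_graph n d) S))"
    by (rule card_edge_boundary_hamming_graph[OF S])
  finally show ?thesis .
qed

section \<open>Numerical estimates\<close>

text \<open>\<open>ln x / x\<close> decreases beyond e, and \<open>exp_le\<close> gives e at most 3.
  Between 2 and 3 it may lie below its value at \<open>d\<close>, which the factor 2 makes up
  for.\<close>

lemma two_ln_div_ge:
  fixes u d :: real
  assumes "2 \<le> u" "u \<le> d" "3 \<le> d"
  shows "ln d / d \<le> 2 * (ln u / u)"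
proof (cases "3 \<le> u")
  case True
  then have "ln d / d \<le> ln u / u"
    using exp_le assms by (intro ln_x_over_x_mono) auto
  moreover have "0 \<le> ln u / u" using assms by simp
  ultimately show ?thesis by linarith
next
  case False
  have "ln d / d \<le> ln 3 / 3"
    using exp_le assms by (intro ln_x_over_x_mono) auto
  \<comment> \<open>Since \<open>ln 4 = 2 * ln 2\<close>, this brings in the lower end
    \<open>2 \<le> u\<close>.\<close>
  also have "\<dots> \<le> ln 4 / 3" by simp
  also have "\<dots> = 2 * ln 2 / 3"
    using ln_realpow[of 2 2] by simp
  also have "\<dots> \<le> 2 * ln u / 3" using assms by simp
  also have "\<dots> \<le> 2 * ln u / u"
    using assms False by (intro divide_left_mono) auto
  finally show ?thesis by simp
qed

text \<open>With \<open>u = N / s\<close> the right side is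
  \<open>(n - 1) * N * log n u / u\<close>, which \<open>two_ln_div_ge\<close> controls for
  \<open>u \<le> d\<close>. Once \<open>u\<close> exceeds \<open>d\<close>, the logarithm is at
  least \<open>log n d\<close> and \<open>lo\<close> bounds the factor \<open>s\<close>.\<close>

lemma isoperimetric_bound_ge:
  fixes N s :: real and n d :: nat
  assumes n: "n \<ge> 3" and d: "d \<ge> 3" and N: "N = real n ^ d"
    and lo: "N - 1 \<le> d * (real n - 1) * s" and hi: "s \<le> N / 2" and s: "0 < s"
  shows "(N - 1) * log n d / d \<le> (real n - 1) * s * (real d - log n s)"
proof -
  have Npos: "N > 1" unfolding N using n d by simp
  have ln: "ln (real n) > 0" using n by simp
  define u where "u = N / s"
  have u: "u \<ge> 2" "u > 0" "s = N / u"
    using hi s Npos by (auto simp: u_def field_simps)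
  have dlog: "real d - log n s = log n u"
    using ln s Npos n by (simp add: log_def u_def ln_div N ln_realpow field_simps)
  show ?thesis
  proof (cases "u \<le> d")
    case True
    have "(N - 1) * log n d / d \<le> N * (ln d / d) / ln n"
      using ln d by (simp add: log_def divide_simps)
    also have "\<dots> \<le> N * (2 * (ln u / u)) / ln n"
      using two_ln_div_ge[of u d] u(1) True d ln Npos
      by (intro divide_right_mono mult_left_mono) auto
    also have "\<dots> = 2 * (s * log n u)" by (simp add: u(3) log_def)
    \<comment> \<open>The factor 2 is absorbed here, because \<open>n \<ge> 3\<close>.\<close>
    also have "\<dots> \<le> (real n - 1) * (s * log n u)"
      using n s u(1) by (intro mult_right_mono mult_nonneg_nonneg) auto
    finally show ?thesis by (simp add: dlog)
  next
    case False
    have "(N - 1) * log n d / d \<le> (d * (real n - 1) * s) * log n d / d"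
      using lo n d by (intro divide_right_mono mult_right_mono) auto
    also have "\<dots> = (real n - 1) * s * log n d" using d by simp
    also have "\<dots> \<le> (real n - 1) * s * log n u"
      using False n d s u(1,2) by (intro mult_left_mono mult_nonneg_nonneg) auto
    finally show ?thesis by (simp add: dlog)
  qed
qed

subsection \<open>Balanced edges of trees\<close>

text \<open>\<open>connected\<close> means strong connectivity of the symmetric closure, which
  leaves reachability unchanged when the arcs are already symmetric.\<close>

lemma connected_pair_graph_iff:
  assumes "pair_graph G"
  shows "Digraph_Component.connected (with_proj G) \<longleftrightarrow>
    pverts G \<noteq> {} \<and> (\<forall>u\<in>pverts G. \<forall>v\<in>pverts G. u \<rightarrow>\<^sup>*\<^bsub>with_proj G\<^esub> v)"
proof -
  interpret pair_graph G by fact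
  show ?thesis
    using reachable_mk_symmetric_eq[OF sym_arcs]
    by (simp add: connected_def strongly_connected_def)
qed

text \<open>Reachability is symmetric here, so one direction determines the strong component. Sides
  thus become accessible to induction along walks.\<close>

lemma edge_side_conv_reachable:
  assumes "pair_graph T"
  shows "edge_side T e = {w. fst e \<rightarrow>\<^sup>*\<^bsub>with_proj (delete_edge T e)\<^esub> w}"
proof -
  interpret T': pair_graph "delete_edge T e" by (rule pair_graph_delete_edge[OF assms])
  show ?thesis
    unfolding edge_side_def using symmetric_reachable[OF T'.sym_arcs] by (auto simp: T'.scc_of_def)
qed

lemma pverts_delete_edge [simp]: "pverts (delete_edge T e) = pverts T"
  by (simp add: delete_edge_def)

lemma parcs_delete_edge [simp]: "parcs (delete_edge T e) = parcs T - {e, prod.swap e}"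
  by (simp add: delete_edge_def)

lemma edge_side_subset_pverts:
  assumes "pair_graph T"
  shows "edge_side T e \<subseteq> pverts T"
proof -
  interpret T': pair_graph "delete_edge T e" by (rule pair_graph_delete_edge[OF assms])
  show ?thesis
    using T'.reachable_in_verts(2) by (auto simp: edge_side_conv_reachable[OF assms])
qed

lemma tail_in_edge_side:
  assumes "pair_graph T" "(u, v) \<in> parcs T"
  shows "u \<in> edge_side T (u, v)"
proof -
  interpret T: pair_graph T by fact
  interpret T': pair_graph "delete_edge T (u, v)" by (rule pair_graph_delete_edge[OF assms(1)])
  show ?thesis
    using T.in_arcsD1[OF assms(2)]
    by (simp add: edge_side_conv_reachable[OF assms(1)] T'.reachable_refl)
qed

lemma head_notin_edge_side:
  assumes "undirected_tree T" "(u, v) \<in> parcs T"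
  shows "v \<notin> edge_side T (u, v)"
proof -
  interpret T: pair_graph T using assms(1) by (simp add: undirected_tree_def)
  have "v \<in> edge_side T (v, u)"
    by (rule tail_in_edge_side[OF T.pair_graph T.arcs_symmetric[OF assms(2)]])
  then show ?thesis
    using edge_side_swap[OF assms] by simp
qed

text \<open>\<open>edge_side T (w, u)\<close> is the branch at \<open>u\<close> through
  \<open>w\<close>. On a walk from \<open>u\<close>, a step out of \<open>u\<close> enters the
  branch of the vertex reached, and a step that avoids \<open>u\<close> stays in its branch because
  it does not use the deleted edge.\<close>

lemma edge_sides_cover:
  assumes tree: "undirected_tree T" and u: "u \<in> pverts T"
  shows "pverts T - {u} \<subseteq> (\<Union>w\<in>{w. (w, u) \<in> parcs T}. edge_side T (w, u))"
proof
  fix y assume y: "y \<in> pverts T - {u}"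
  interpret T: pair_graph T using tree by (simp add: undirected_tree_def)
  have "u \<rightarrow>\<^sup>*\<^bsub>with_proj T\<^esub> y"
    using tree u y connected_pair_graph_iff[OF T.pair_graph] by (auto simp: undirected_tree_def)
  then have "y = u \<or> (\<exists>w. (w, u) \<in> parcs T \<and> y \<in> edge_side T (w, u))"
  proof (induction rule: T.reachable_induct)
    case base
    then show ?case by simp
  next
    case (step x y)
    show ?case
    proof (cases "x = u \<or> y = u")
      case True
      then show ?thesis
        using step.hyps(2) T.arcs_symmetric tail_in_edge_side[OF T.pair_graph] by blast
    next
      case False
      then obtain w where w: "(w, u) \<in> parcs T" "x \<in> edge_side T (w, u)"
        using step.IH by blast
      interpret T': pair_graph "delete_edge T (w, u)"
        by (rule pair_graph_delete_edge[OF T.pair_graph])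
      have "(x, y) \<in> parcs (delete_edge T (w, u))"
        using step.hyps(2) False by simp
      then have "y \<in> edge_side T (w, u)"
        using w(2) T'.reachable_adj_trans by (simp add: edge_side_conv_reachable[OF T.pair_graph])
      with w(1) show ?thesis by blast
    qed
  qed
  with y show "y \<in> (\<Union>w\<in>{w. (w, u) \<in> parcs T}. edge_side T (w, u))" by blast
qed

text \<open>Seen from \<open>v\<close>, the branch through \<open>w\<close> lies behind
  \<open>u\<close>, and \<open>u\<close> itself makes the inclusion strict. The inclusion is proved
  for the complements, by induction along walks from \<open>v\<close>.\<close>

lemma edge_side_psubset:
  assumes tree: "undirected_tree T" and arcs: "(u, v) \<in> parcs T" "(w, u) \<in> parcs T" "w \<noteq> v"
  shows "edge_side T (w, u) \<subset> edge_side T (u, v)"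
proof -
  interpret T: pair_graph T using tree by (simp add: undirected_tree_def)
  interpret T': pair_graph "delete_edge T (v, u)" by (rule pair_graph_delete_edge[OF T.pair_graph])
  interpret T'': pair_graph "delete_edge T (u, w)" by (rule pair_graph_delete_edge[OF T.pair_graph])
  note conv = edge_side_conv_reachable[OF T.pair_graph]
  have vu: "(v, u) \<in> parcs T" and uw: "(u, w) \<in> parcs T"
    using arcs T.arcs_symmetric by blast+
  have "edge_side T (v, u) \<subseteq> edge_side T (u, w)"
  proof
    fix y assume "y \<in> edge_side T (v, u)"
    then have "v \<rightarrow>\<^sup>*\<^bsub>with_proj (delete_edge T (v, u))\<^esub> y" by (simp add: conv)
    then show "y \<in> edge_side T (u, w)"
    proof (induction rule: T'.reachable_induct)
      case base
      have "(u, v) \<in> parcs (delete_edge T (u, w))"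
        using arcs T.no_loops' by auto
      then show ?case by (simp add: conv T''.reachable_adjI)
    next
      case (step x y)
      \<comment> \<open>A walk from \<open>v\<close> that avoids the edge \<open>{u, v}\<close>
        never meets \<open>u\<close>, hence cannot use the edge \<open>{u, w}\<close>.\<close>
      have "x \<noteq> u" "y \<noteq> u"
        using step.hyps T'.reachable_adj_trans head_notin_edge_side[OF tree vu]
        by (auto simp: conv)
      then have "(x, y) \<in> parcs (delete_edge T (u, w))"
        using step.hyps(2) by auto
      then show ?case
        using step.IH T''.reachable_adj_trans by (simp add: conv)
    qed
  qed
  moreover have "edge_side T (w, u) = pverts T - edge_side T (u, w)"
    "edge_side T (u, v) = pverts T - edge_side T (v, u)"
    using edge_side_swap[OF tree uw] edge_side_swap[OF tree vu] by simp_all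
  ultimately have "edge_side T (w, u) \<subseteq> edge_side T (u, v)" by blast
  moreover have "u \<in> edge_side T (u, v)" "u \<notin> edge_side T (w, u)"
    using tail_in_edge_side[OF T.pair_graph arcs(1)] head_notin_edge_side[OF tree arcs(2)] by auto
  ultimately show ?thesis by blast
qed

lemma card_edge_side_swap:
  assumes tree: "undirected_tree T" and e: "e \<in> parcs T"
  shows "card (edge_side T (prod.swap e)) + card (edge_side T e) = card (pverts T)"
proof -
  interpret T: pair_graph T using tree by (simp add: undirected_tree_def)
  have "edge_side T e \<subseteq> pverts T" by (rule edge_side_subset_pverts[OF T.pair_graph])
  then show ?thesis
    using edge_side_swap[OF assms] T.pair_finite_verts
    by (simp add: card_Diff_subset finite_subset card_mono)
qed

text \<open>Among the sides with at least half of the vertices, a smallest one has a centroid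
  \<open>u\<close> as its tail: no branch at \<open>u\<close> exceeds half. At most \<open>k\<close>
  branches cover all vertices but \<open>u\<close>, hence the \<open>+ 1\<close>, and the largest
  branch meets both bounds.\<close>

lemma balanced_edge_exists:
  assumes tree: "undirected_tree T" and two: "card (pverts T) \<ge> 2"
    and deg: "\<And>u. u \<in> pverts T \<Longrightarrow> card {w. (w, u) \<in> parcs T} \<le> k"
  obtains e where "e \<in> parcs T" "2 * card (edge_side T e) \<le> card (pverts T)"
    "card (pverts T) \<le> k * card (edge_side T e) + 1"
proof -
  interpret T: pair_graph T using tree by (simp add: undirected_tree_def)
  let ?N = "card (pverts T)"
  let ?c = "\<lambda>e. card (edge_side T e)"
  have fin_side: "finite (edge_side T e)" for e
    using edge_side_subset_pverts[OF T.pair_graph] T.pair_finite_verts finite_subset by blast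
  have nonempty: "{w. (w, u) \<in> parcs T} \<noteq> {}" if u: "u \<in> pverts T" for u
  proof
    assume "{w. (w, u) \<in> parcs T} = {}"
    then have "pverts T \<subseteq> {u}" using edge_sides_cover[OF tree u] by auto
    then have "?N \<le> card {u}" by (intro card_mono) auto
    then show False using two by simp
  qed
  obtain x where "x \<in> pverts T" using two by fastforce
  then obtain e0 where e0: "e0 \<in> parcs T" using nonempty by blast
  have "prod.swap e0 \<in> parcs T" using e0 T.arcs_symmetric by (cases e0) auto
  then have "\<exists>e. e \<in> parcs T \<and> ?N \<le> 2 * ?c e"
    using e0 card_edge_side_swap[OF tree e0] by (metis add_le_cancel_left linorder_le_cases mult_2 order_trans add_le_mono1)
  then obtain e where e: "e \<in> parcs T" "?N \<le> 2 * ?c e"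
    and least: "\<And>f. f \<in> parcs T \<Longrightarrow> ?N \<le> 2 * ?c f \<Longrightarrow> ?c e \<le> ?c f"
    using ex_has_least_nat[of "\<lambda>e. e \<in> parcs T \<and> ?N \<le> 2 * ?c e" _ ?c] by blast
  obtain u v where uv: "e = (u, v)" by (cases e)
  let ?W = "{w. (w, u) \<in> parcs T}"
  have u: "u \<in> pverts T" using e uv T.in_arcsD1 by blast
  have small: "2 * ?c (w, u) \<le> ?N" if w: "(w, u) \<in> parcs T" for w
  \<comment> \<open>For \<open>w = v\<close> the branch is the complement of the large side.
    Otherwise it lies strictly inside that side, so by minimality it has less than half of the
    vertices.\<close>
  proof (cases "w = v")
    case True
    then show ?thesis using card_edge_side_swap[OF tree e(1)] e(2) uv by simp
  next
    case False
    then have "edge_side T (w, u) \<subset> edge_side T e"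
      using edge_side_psubset[OF tree] e uv w by blast
    then have "?c (w, u) < ?c e" using fin_side psubset_card_mono by blast
    then show ?thesis using least[OF w] by linarith
  qed
  have finW: "finite ?W"
    by (rule finite_subset[OF _ T.pair_finite_verts]) (auto dest: T.in_arcsD1)
  obtain w where w: "w \<in> ?W" and max: "\<And>w'. w' \<in> ?W \<Longrightarrow> ?c (w', u) \<le> ?c (w, u)"
  proof -
    have "\<exists>w. w \<in> ?W \<and> (\<forall>w'. w' \<in> ?W \<longrightarrow> ?c (w', u) \<le> ?c (w, u))"
      using ex_has_greatest_nat[of "\<lambda>w. w \<in> ?W" _ "\<lambda>w. ?c (w, u)" "Suc ?N"] nonempty[OF u]
        card_mono[OF T.pair_finite_verts edge_side_subset_pverts[OF T.pair_graph]]
      by (metis (no_types, lifting) all_not_in_conv le_imp_less_Suc)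
    then show ?thesis using that by blast
  qed
  have "?N - 1 = card (pverts T - {u})" using u by simp
  also have "\<dots> \<le> card (\<Union>w\<in>?W. edge_side T (w, u))"
    using edge_sides_cover[OF tree u] finW fin_side by (intro card_mono) auto
  also have "\<dots> \<le> (\<Sum>w\<in>?W. ?c (w, u))" by (rule card_UN_le[OF finW])
  also have "\<dots> \<le> card ?W * ?c (w, u)"
    using sum_bounded_above[of ?W "\<lambda>w. ?c (w, u)" "?c (w, u)"] max by simp
  also have "\<dots> \<le> k * ?c (w, u)" using deg[OF u] by simp
  finally have "?N \<le> k * ?c (w, u) + 1" by linarith
  with w small show ?thesis by (intro that[of "(w, u)"]) auto
qed

section \<open>Existence of spanning trees and the minimum in \<open>stc\<close>\<close>

text \<open>The rest \<open>q\<close> of the cycle leads from \<open>v\<close> back to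
  \<open>u\<close>; what has to be shown is that it uses the deleted edge in neither
  direction.\<close>

lemma delete_cycle_edge_reachable:
  assumes G: "pair_graph G" and cyc: "pre_digraph.cycle (with_proj G) ((u, v) # q)" "length q \<ge> 2"
  shows "v \<rightarrow>\<^sup>*\<^bsub>with_proj (delete_edge G (u, v))\<^esub> u"
proof -
  interpret G: pair_graph G by fact
  interpret G': pair_graph "delete_edge G (u, v)" by (rule pair_graph_delete_edge[OF G])
  obtain u' where "G.awalk u' ((u, v) # q) u'" and dist: "distinct (pawalk_verts v q)"
    using cyc(1) by (auto simp: G.cycle_def)
  then have walk: "G.awalk v q u" and uv: "(u, v) \<in> parcs G"
    by (auto simp: G.awalk_Cons_iff)
  have cas: "pcas v q u" and last: "last (pawalk_verts v q) = u"
    using walk by (auto simp: G.awalk_def elim: G.awalkE)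
  obtain x y r where q: "q = (v, x) # (x, y) # r"
  proof (cases q)
    case (Cons a q')
    then show ?thesis using cyc(2) cas that by (cases q'; cases a; cases "hd q'") auto
  qed (use cyc(2) in simp)
  have "snd (last q) = u" "pawalk_verts v q = map fst q @ [snd (last q)]"
    using last G.awalk_verts_conv[of v q] q by auto
  \<comment> \<open>No arc of \<open>q\<close> leaves \<open>u\<close>, which excludes
    \<open>(u, v)\<close>. Only the first arc leaves \<open>v\<close>, and its head \<open>x\<close>
    is the tail of the second, hence not \<open>u\<close>, which excludes
    \<open>(v, u)\<close>.\<close>
  then have "distinct (map fst q @ [u])" using dist by simp
  then have "(u, v) \<notin> set q" "(v, u) \<notin> set q"
    by (auto simp: q rev_image_eqI)
  then have "G'.awalk v q u"
    using walk by (auto simp: G'.awalk_def G.awalk_def)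
  then show ?thesis by (rule G'.reachable_awalkI)
qed

text \<open>A connected spanning subgraph with the fewest arcs has no cycle of length at least 3: an
  edge of such a cycle can be bypassed along the rest of it and deleted.\<close>

lemma undirected_spanning_tree_exists:
  assumes G: "pair_graph G" and conn: "Digraph_Component.connected (with_proj G)"
  shows "\<exists>T. undirected_spanning_tree T G"
proof -
  interpret G: pair_graph G by fact
  let ?P = "\<lambda>T. pair_graph T \<and> Digraph_Component.connected (with_proj T) \<and>
    pverts T = pverts G \<and> parcs T \<subseteq> parcs G"
  obtain T where "?P T" and least: "\<And>T'. ?P T' \<Longrightarrow> card (parcs T) \<le> card (parcs T')"
    using ex_has_least_nat[of ?P G "\<lambda>T. card (parcs T)"] G conn by blast
  then have T: "pair_graph T" "Digraph_Component.connected (with_proj T)"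
    "pverts T = pverts G" "parcs T \<subseteq> parcs G" by auto
  interpret T: pair_graph T by fact
  have "\<not> T.cycle p" if len: "length p \<ge> 3" for p
  proof
    assume cyc: "T.cycle p"
    obtain u v q where p: "p = (u, v) # q" using len by (cases p) auto
    have uv: "(u, v) \<in> parcs T" using cyc by (auto simp: p T.cycle_def T.awalk_Cons_iff)
    let ?T' = "delete_edge T (u, v)"
    interpret T': pair_graph ?T' by (rule pair_graph_delete_edge[OF T(1)])
    have vu: "v \<rightarrow>\<^sup>*\<^bsub>with_proj ?T'\<^esub> u"
      using delete_cycle_edge_reachable[OF T(1)] cyc len p by auto
    then have uv': "u \<rightarrow>\<^sup>*\<^bsub>with_proj ?T'\<^esub> v"
      using symmetric_reachable[OF T'.sym_arcs] by blast
    have "x \<rightarrow>\<^sup>*\<^bsub>with_proj ?T'\<^esub> y" if "x \<rightarrow>\<^sup>*\<^bsub>with_proj T\<^esub> y" for x y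
      using that
    proof (induction rule: T.reachable_induct)
      case base
      then show ?case by (simp add: T'.reachable_refl)
    next
      case (step y z)
      have "y \<rightarrow>\<^sup>*\<^bsub>with_proj ?T'\<^esub> z"
      proof (cases "(y, z) \<in> parcs ?T'")
        case True
        then show ?thesis by (rule T'.reachable_adjI)
      next
        case False
        then show ?thesis using step.hyps(2) uv' vu by auto
      qed
      then show ?case by (rule T'.reachable_trans[OF step.IH])
    qed
    then have "Digraph_Component.connected (with_proj ?T')"
      using T(2) by (simp add: connected_pair_graph_iff[OF T(1)]
          connected_pair_graph_iff[OF T'.pair_graph])
    then have "card (parcs T) \<le> card (parcs ?T')"
      using T T'.pair_graph by (intro least) auto
    moreover have "parcs ?T' \<subset> parcs T" using uv by auto
    ultimately show False
      using psubset_card_mono[OF T.pair_finite_arcs, of "parcs ?T'"] by linarith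
  qed
  then have "undirected_tree T" using T by (auto simp: undirected_tree_def)
  moreover have "spanning (with_proj T) (with_proj G)"
    using T by (simp add: spanning_def subgraph_def compatible_def wf_digraph_wp_iff
        T.pair_wf_digraph G.pair_wf_digraph)
  ultimately show ?thesis by (auto simp: undirected_spanning_tree_def)
qed

lemma edge_congestion_le_congestion:
  assumes "pair_graph T" "e \<in> parcs T"
  shows "edge_congestion G T e \<le> congestion G T"
proof -
  interpret pair_graph T by fact
  show ?thesis using assms(2) pair_finite_arcs by (simp add: congestion_def)
qed

text \<open>\<open>Min\<close> is a true minimum on a finite nonempty set. A spanning tree is
  determined by its arcs, a subset of \<open>parcs G\<close>, and one exists by
  connectivity.\<close>

lemma stc_attained:
  assumes G: "pair_graph G" and conn: "Digraph_Component.connected (with_proj G)"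
  obtains T where "undirected_spanning_tree T G" "stc G = congestion G T"
proof -
  interpret G: pair_graph G by fact
  have "{T. undirected_spanning_tree T G} \<subseteq> (\<lambda>A. \<lparr>pverts = pverts G, parcs = A\<rparr>) ` Pow (parcs G)"
  proof
    fix T assume "T \<in> {T. undirected_spanning_tree T G}"
    then have "T = \<lparr>pverts = pverts G, parcs = parcs T\<rparr>" "parcs T \<subseteq> parcs G"
      by (auto simp: undirected_spanning_tree_def spanning_def subgraph_def)
    then show "T \<in> (\<lambda>A. \<lparr>pverts = pverts G, parcs = A\<rparr>) ` Pow (parcs G)" by blast
  qed
  then have "finite {T. undirected_spanning_tree T G}"
    using G.pair_finite_arcs by (auto intro: finite_subset)
  moreover have "{congestion G T | T. undirected_spanning_tree T G}
      = congestion G ` {T. undirected_spanning_tree T G}" by blast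
  ultimately have "stc G \<in> {congestion G T | T. undirected_spanning_tree T G}"
    unfolding stc_def using undirected_spanning_tree_exists[OF assms] by (intro Min_in) auto
  then show ?thesis using that by blast
qed

subsection \<open>Spanning trees of Hamming graphs\<close>

text \<open>The coordinates of \<open>x\<close> are replaced by those of \<open>y\<close> one at a
  time; consecutive points \<open>z k\<close> are equal or adjacent. Connectivity includes
  nonemptiness, for which \<open>n \<ge> 1\<close> supplies the zero vector.\<close>

lemma connected_hamming_graph:
  assumes "n \<ge> 1"
  shows "Digraph_Component.connected (with_proj (hamming_graph n d))"
proof -
  let ?G = "hamming_graph n d"
  interpret G: pair_graph ?G by (rule pair_graph_hamming_graph)
  have "x \<rightarrow>\<^sup>*\<^bsub>with_proj ?G\<^esub> y" if x: "x \<in> pverts ?G" and y: "y \<in> pverts ?G" for x y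
  proof -
    define z where "z k i = (if i < k then y i else x i)" for k i :: nat
    note x' = x[unfolded pverts_hamming_graph] and y' = y[unfolded pverts_hamming_graph]
    have z: "z k \<in> pverts ?G" if "k \<le> d" for k
      using x y that by (auto simp: z_def pverts_hamming_graph PiE_iff extensional_def)
    have "x \<rightarrow>\<^sup>*\<^bsub>with_proj ?G\<^esub> z k" if "k \<le> d" for k
      using that
    proof (induction k)
      case 0
      have "z 0 = x" by (simp add: z_def fun_eq_iff)
      then show ?case using x by (simp add: G.reachable_refl)
    next
      case (Suc k)
      have upd: "z (Suc k) = (z k)(k := y k)"
        by (auto simp: z_def fun_eq_iff less_Suc_eq)
      show ?case
      proof (cases "z k k = y k")
        case True
        then have "z (Suc k) = z k" unfolding upd by (rule fun_upd_idem)
        moreover have "x \<rightarrow>\<^sup>*\<^bsub>with_proj ?G\<^esub> z k"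
          using Suc.prems by (intro Suc.IH) simp
        ultimately show ?thesis by (simp only:)
      next
        case False
        have "y k < n" using PiE_mem[OF y', of k] Suc.prems by simp
        then have "(z k, z (Suc k)) \<in> parcs ?G"
          unfolding upd using z[of k] Suc.prems False by (intro fun_upd_in_parcs) simp_all
        moreover have "x \<rightarrow>\<^sup>*\<^bsub>with_proj ?G\<^esub> z k"
          using Suc.prems by (intro Suc.IH) simp
        ultimately show ?thesis using G.reachable_adj_trans by blast
      qed
    qed
    moreover have "z d = y"
      unfolding z_def using PiE_arb[OF x'] PiE_arb[OF y'] by (intro ext) simp
    ultimately show ?thesis by (metis order_refl)
  qed
  moreover have "(\<lambda>i\<in>{..<d}. 0) \<in> pverts ?G"
    using assms by (auto simp: pverts_hamming_graph)
  ultimately show ?thesis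
    by (auto simp: connected_pair_graph_iff[OF pair_graph_hamming_graph])
qed

text \<open>This degree bound serves as \<open>k\<close> in
  \<open>balanced_edge_exists\<close>.\<close>

lemma card_neighbours_hamming_graph_le:
  assumes u: "u \<in> pverts (hamming_graph n d)"
  shows "card {w. (w, u) \<in> parcs (hamming_graph n d)} \<le> d * (n - 1)"
proof -
  interpret G: pair_graph "hamming_graph n d" by (rule pair_graph_hamming_graph)
  let ?I = "Sigma {..<d} (\<lambda>i. {..<n} - {u i})"
  have "{w. (w, u) \<in> parcs (hamming_graph n d)} \<subseteq> (\<lambda>(i, t). u(i := t)) ` ?I"
  proof
    fix w assume "w \<in> {w. (w, u) \<in> parcs (hamming_graph n d)}"
    then have "(u, w) \<in> parcs (hamming_graph n d)" using G.arcs_symmetric by simp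
    then obtain i t where "i < d" "t < n" "u i \<noteq> t" "w = u(i := t)"
      by (rule parcs_hamming_graphE)
    then show "w \<in> (\<lambda>(i, t). u(i := t)) ` ?I"
      by (intro image_eqI[of _ _ "(i, t)"]) auto
  qed
  then have "card {w. (w, u) \<in> parcs (hamming_graph n d)} \<le> card ?I"
    by (rule surj_card_le[rotated]) simp
  also have "\<dots> = (\<Sum>i<d. card ({..<n} - {u i}))" by simp
  also have "\<dots> = (\<Sum>i<d. n - 1)"
    using PiE_mem[OF u[unfolded pverts_hamming_graph]] by (intro sum.cong) simp_all
  finally show ?thesis by simp
qed

theorem theorem1:
  fixes n d :: nat
  assumes "n \<ge> 3" and "d \<ge> 3"
  shows "real (stc (hamming_graph n d)) \<ge> (real n ^ d - 1) * log (real n) (real d) / real d"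
proof -
  let ?G = "hamming_graph n d"
  interpret G: pair_graph ?G by (rule pair_graph_hamming_graph)
  have "1 \<le> n" using assms by simp
  obtain T where span: "undirected_spanning_tree T ?G" and stc: "stc ?G = congestion ?G T"
    by (rule stc_attained[OF pair_graph_hamming_graph connected_hamming_graph[OF \<open>1 \<le> n\<close>]])
  have tree: "undirected_tree T" and sub: "parcs T \<subseteq> parcs ?G" and V: "pverts T = pverts ?G"
    using span by (auto simp: undirected_spanning_tree_def spanning_def subgraph_def)
  interpret T: pair_graph T using tree by (simp add: undirected_tree_def)
  have N: "card (pverts T) = n ^ d" by (simp add: V card_pverts_hamming_graph)
  have "n ^ 1 \<le> n ^ d" using assms by (intro power_increasing) auto
  then have two: "2 \<le> card (pverts T)" using assms by (simp add: N)
  have deg: "card {w. (w, u) \<in> parcs T} \<le> d * (n - 1)" if "u \<in> pverts T" for u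
  proof -
    have "card {w. (w, u) \<in> parcs T} \<le> card {w. (w, u) \<in> parcs ?G}"
      by (rule card_mono, rule finite_subset[OF _ G.pair_finite_verts])
        (use sub G.in_arcsD1 in blast)+
    also have "\<dots> \<le> d * (n - 1)"
      using that V by (intro card_neighbours_hamming_graph_le) simp
    finally show ?thesis .
  qed
  \<comment> \<open>The two size bounds form the window for the side that
    \<open>isoperimetric_bound_ge\<close> requires.\<close>
  obtain e where e: "e \<in> parcs T" "2 * card (edge_side T e) \<le> n ^ d"
    "n ^ d \<le> d * (n - 1) * card (edge_side T e) + 1"
    using balanced_edge_exists[OF tree two deg] N by metis
  let ?s = "real (card (edge_side T e))"
  have "real (n ^ d) \<le> real (d * (n - 1) * card (edge_side T e) + 1)"
    using e(3) by (rule of_nat_mono)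
  then have lo: "real n ^ d - 1 \<le> d * (real n - 1) * ?s"
    using assms by (simp add: of_nat_diff)
  have "real (2 * card (edge_side T e)) \<le> real (n ^ d)"
    using e(2) by (rule of_nat_mono)
  then have hi: "?s \<le> real n ^ d / 2" by simp
  \<comment> \<open>An empty side would force \<open>n ^ d \<le> 1\<close>, against
    \<open>two\<close>; so the argument of the logarithm is positive.\<close>
  have "card (edge_side T e) \<noteq> 0"
    using e(3) two N by (intro notI) simp
  then have "(real n ^ d - 1) * log n d / d \<le> (real n - 1) * ?s * (real d - log n ?s)"
    using isoperimetric_bound_ge[OF assms refl lo hi] by simp
  also have "\<dots> \<le> real (edge_congestion ?G T e)"
    unfolding edge_congestion_def
    using edge_side_subset_pverts[OF T.pair_graph] V assms
    by (intro hamming_graph_edge_isoperimetry) auto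
  also have "\<dots> \<le> real (stc ?G)"
    unfolding stc using edge_congestion_le_congestion[OF T.pair_graph e(1)] by simp
  finally show ?thesis .
qed

end
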